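(* If $F_C$ is the inhomogeneous product attractor of $T_\theta$, then $F_C=\prod_{k=1}^m F_{C_k}$. In particular, $F_C=\prod_{k=1}^m(O_k\cup F_k)$.
   Context: Let $(X_k,d_k)$, $k=1,\dots,m$, be complete metric spaces, $X=\prod_{k=1}^m X_k$ with product metric $d_0(\vec{x},\vec{y})=\left(\sum_{k=1}^m d_k(x_k,y_k)^2\right)^{1/2}$. $\mathscr{H}(Y)$ denotes the set of nonempty compact subsets of $Y$, and $\mathscr{H}=\{A_1\times\cdots\times A_m: A_k\in\mathscr{H}(X_k)\}$. For each $k$, let $w_{ki_k}:X_k\to X_k$, $i_k=1,\dots,N_k$, be contractions with contractivity factors $0\le c_{ki_k}<1$, let $C_k\in\mathscr{H}(X_k)$ (the condensation set), and let $w_{k0}:\mathscr{H}(X_k)\to\mathscr{H}(X_k)$, $w_{k0}(B)=C_k$ for all $B$. The homogeneous attractor $F_k$ is the unique $F_k\in\mathscr{H}(X_k)$ with $F_k=\bigcup_{i_k=1}^{N_k}w_{ki_k}(F_k)$; the inhomogeneous attractor $F_{C_k}$ is the unique element of $\mathscr{H}(X_k)$ with $F_{C_k}=\bigcup_{i_k=0}^{N_k}w_{ki_k}(F_{C_k})$. The orbital set is $O_k=C_k\cup\bigcup_{\mathbf{j}\in J_k^*}w_{k\mathbf{j}}(C_k)$, where $J_k=\{1,\dots,N_k\}$, $J_k^*=\bigcup_{n=1}^\infty J_k^n$, and $w_{k\mathbf{j}}=w_{kj_1}w_{kj_2}\cdots w_{kj_n}$ (composition) for $\mathbf{j}=j_1j_2\ldots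 j_n\in J_k^n$. For $0\le i_k\le N_k$ and $B=\prod_{k=1}^m B_k\in\mathscr{H}$ put $T_{i_1\ldots i_m}(B)=\prod_{k=1}^m w_{ki_k}(B_k)$, and $T_\theta(B)=\bigcup_{i_1=0}^{N_1}\cdots\bigcup_{i_m=0}^{N_m}T_{i_1\ldots i_m}(B)$, which maps $\mathscr{H}$ to $\mathscr{H}$. The inhomogeneous product attractor $F_C$ (with $C=\prod_{k=1}^m C_k$) is the unique fixed point of $T_\theta$ in $\mathscr{H}$. *)

theory Defs
  imports "HOL-Analysis.Analysis"
begin

definition nonempty_compacts :: "'a metric \<Rightarrow> 'a set set" where
  "nonempty_compacts M = {A. A \<noteq> {} \<and> compactin (mtopology_of M) A}"

definition contraction :: "'a metric \<Rightarrow> real \<Rightarrow> ('a \<Rightarrow> 'a) \<Rightarrow> bool" where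
  "contraction M c f \<longleftrightarrow> f \<in> mspace M \<rightarrow> mspace M \<and> 0 \<le> c \<and> c < 1 \<and>
     (\<forall>x\<in>mspace M. \<forall>y\<in>mspace M. mdist M (f x) (f y) \<le> c * mdist M x y)"

(* The action on sets: w 1, w 2, ... act by taking images; index 0 is the constant map
   with value the condensation set C (the function w 0 is never used). *)
definition set_map :: "(nat \<Rightarrow> 'a \<Rightarrow> 'a) \<Rightarrow> 'a set \<Rightarrow> nat \<Rightarrow> 'a set \<Rightarrow> 'a set" where
  "set_map w C i B = (if i = 0 then C else w i ` B)"

(* Existence and uniqueness of the sets described by THE here and in product_attractor hold
   for contractions of a complete space with N \<ge> 1, but are not built into the definitions. *)
definition homogeneous_attractor :: "'a metric \<Rightarrow> nat \<Rightarrow> (nat \<Rightarrow> 'a \<Rightarrow> 'a) \<Rightarrow> 'a set" where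
  "homogeneous_attractor M N w =
     (THE F. F \<in> nonempty_compacts M \<and> F = (\<Union>i\<in>{1..N}. w i ` F))"

definition inhomogeneous_attractor ::
  "'a metric \<Rightarrow> nat \<Rightarrow> (nat \<Rightarrow> 'a \<Rightarrow> 'a) \<Rightarrow> 'a set \<Rightarrow> 'a set" where
  "inhomogeneous_attractor M N w C =
     (THE F. F \<in> nonempty_compacts M \<and> F = (\<Union>i\<in>{0..N}. set_map w C i F))"

definition word_map :: "(nat \<Rightarrow> 'a \<Rightarrow> 'a) \<Rightarrow> nat list \<Rightarrow> 'a \<Rightarrow> 'a" where
  "word_map w js = foldr (\<lambda>j g. w j \<circ> g) js id"

definition orbital_set :: "nat \<Rightarrow> (nat \<Rightarrow> 'a \<Rightarrow> 'a) \<Rightarrow> 'a set \<Rightarrow> 'a set" where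
  "orbital_set N w C = C \<union> (\<Union>js\<in>lists {1..N} - {[]}. word_map w js ` C)"

(* Points of the product of X 1, ..., X m are functions in the extensional product PiE {1..m}. *)
definition compact_boxes :: "nat \<Rightarrow> (nat \<Rightarrow> 'a metric) \<Rightarrow> (nat \<Rightarrow> 'a) set set" where
  "compact_boxes m X = {PiE {1..m} A | A. \<forall>k\<in>{1..m}. A k \<in> nonempty_compacts (X k)}"

(* For a box B with nonempty factors, the k-th factor is the projection {x k | x. x \<in> B}. *)
definition box_map ::
  "nat \<Rightarrow> (nat \<Rightarrow> nat \<Rightarrow> 'a \<Rightarrow> 'a) \<Rightarrow> (nat \<Rightarrow> 'a set) \<Rightarrow> (nat \<Rightarrow> nat) \<Rightarrow>
   (nat \<Rightarrow> 'a) set \<Rightarrow> (nat \<Rightarrow> 'a) set" where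
  "box_map m w C i B = (\<Pi>\<^sub>E k\<in>{1..m}. set_map (w k) (C k) (i k) ((\<lambda>x. x k) ` B))"

definition T_theta ::
  "nat \<Rightarrow> (nat \<Rightarrow> nat) \<Rightarrow> (nat \<Rightarrow> nat \<Rightarrow> 'a \<Rightarrow> 'a) \<Rightarrow> (nat \<Rightarrow> 'a set) \<Rightarrow>
   (nat \<Rightarrow> 'a) set \<Rightarrow> (nat \<Rightarrow> 'a) set" where
  "T_theta m N w C B = (\<Union>i\<in>(\<Pi>\<^sub>E k\<in>{1..m}. {0..N k}). box_map m w C i B)"

definition product_attractor ::
  "nat \<Rightarrow> (nat \<Rightarrow> 'a metric) \<Rightarrow> (nat \<Rightarrow> nat) \<Rightarrow> (nat \<Rightarrow> nat \<Rightarrow> 'a \<Rightarrow> 'a) \<Rightarrow>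
   (nat \<Rightarrow> 'a set) \<Rightarrow> (nat \<Rightarrow> 'a) set" where
  "product_attractor m X N w C = (THE F. F \<in> compact_boxes m X \<and> T_theta m N w C F = F)"

end

theory Submission
  imports Defs
begin

text \<open>
  The operator \<open>T_theta\<close> acts factorwise: since a union over all index tuples of boxes is the box
  of the factorwise unions, a box is fixed by \<open>T_theta\<close> exactly when each of its factors solves
  the inhomogeneous equation \<open>F = C \<union> W F\<close>, where \<open>W F\<close> is the union of the images of \<open>F\<close>
  under the contractions of that factor (\<open>T_theta_fixed_box_iff\<close>). Everything therefore reduces
  to one complete metric space.

  On one factor the main tool is a comparison principle (\<open>comparison\<close>): a bounded set \<open>A\<close> with
  \<open>A \<subseteq> D \<union> W A\<close> lies in every nonempty closed set \<open>B\<close> with \<open>D \<union> W B \<subseteq> B\<close>. Unfolding the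
  first inclusion \<open>n\<close> times leaves two kinds of points of \<open>A\<close>. Images of points of \<open>D\<close> under at
  most \<open>n - 1\<close> contractions lie in \<open>B\<close>. Images of points of \<open>A\<close> under \<open>n\<close> contractions are within
  \<open>r ^ n * R\<close> of \<open>B\<close>, where \<open>r < 1\<close> is a common contraction ratio and \<open>R\<close> bounds the distances
  from \<open>A\<close> to a point of \<open>B\<close>.

  The principle gives uniqueness of both attractors by symmetry. It also gives \<open>F_C = O \<union> F\<close>:
  the orbital set \<open>O\<close> lies in \<open>F_C\<close> because it is the least set containing \<open>C\<close> and closed under
  the contractions, \<open>F \<subseteq> F_C\<close> by comparison, and a point of \<open>F_C - O\<close> can only be the image of a
  point of \<open>F_C - O\<close>, so that \<open>F_C - O \<subseteq> F\<close> by comparison with \<open>D\<close> empty.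

  Existence of the inhomogeneous attractor comes from taking the closure of \<open>O\<close>: the orbital set
  is totally bounded because its finite stages, which are compact, approximate it uniformly.
  A homogeneous attractor is the inhomogeneous one whose condensation set is the fixed point of
  one of the contractions.
\<close>

section \<open>Orbital sets\<close>

definition hutchinson :: "nat \<Rightarrow> (nat \<Rightarrow> 'a \<Rightarrow> 'a) \<Rightarrow> 'a set \<Rightarrow> 'a set" where
  "hutchinson N w B = (\<Union>i\<in>{1..N}. w i ` B)"

lemma hutchinson_mono: "A \<subseteq> B \<Longrightarrow> hutchinson N w A \<subseteq> hutchinson N w B"
  by (auto simp: hutchinson_def)

lemma Union_set_map_eq: "(\<Union>i\<in>{0..N}. set_map w C i B) = C \<union> hutchinson N w B"
proof -
  have "{0..N} = insert 0 {1..N}" by auto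
  then have "(\<Union>i\<in>{0..N}. set_map w C i B) = (\<Union>i\<in>insert 0 {1..N}. set_map w C i B)"
    by (rule arg_cong)
  also have "\<dots> = set_map w C 0 B \<union> (\<Union>i\<in>{1..N}. set_map w C i B)"
    by (rule UN_insert)
  also have "(\<Union>i\<in>{1..N}. set_map w C i B) = hutchinson N w B"
    unfolding hutchinson_def by (rule SUP_cong) (auto simp: set_map_def)
  finally show ?thesis by (simp add: set_map_def)
qed

text \<open>The set \<open>C\<close> itself is the contribution of the empty word.\<close>

lemma orbital_set_eq_words: "orbital_set N w C = (\<Union>js\<in>lists {1..N}. word_map w js ` C)"
proof -
  have "lists {1..N} = insert [] (lists {1..N} - {[]})" by auto
  then have "(\<Union>js\<in>lists {1..N}. word_map w js ` C) =
      (\<Union>js\<in>insert [] (lists {1..N} - {[]}). word_map w js ` C)"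
    by (rule arg_cong)
  also have "\<dots> = word_map w [] ` C \<union> (\<Union>js\<in>lists {1..N} - {[]}. word_map w js ` C)"
    by (rule UN_insert)
  finally show ?thesis by (simp add: orbital_set_def word_map_def)
qed

lemma word_map_Cons: "word_map w (j # js) x = w j (word_map w js x)"
  by (simp add: word_map_def)

lemma orbital_set_least:
  assumes "C \<union> hutchinson N w B \<subseteq> B"
  shows "orbital_set N w C \<subseteq> B"
proof -
  have "word_map w js x \<in> B" if "js \<in> lists {1..N}" "x \<in> C" for js x
    using that
  proof (induction js)
    case Nil
    then show ?case using assms by (auto simp: word_map_def)
  next
    case (Cons j js)
    then have "word_map w (j # js) x \<in> hutchinson N w B"
      by (auto simp: word_map_Cons hutchinson_def)
    then show ?case using assms by blast
  qed
  then show ?thesis by (auto simp: orbital_set_eq_words)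
qed

lemma orbital_set_fixed: "C \<union> hutchinson N w (orbital_set N w C) = orbital_set N w C" (is "?L = ?O")
proof
  show le: "?L \<subseteq> ?O"
  proof -
    have "w i y \<in> ?O" if i: "i \<in> {1..N}" and y: "y \<in> ?O" for i y
    proof -
      obtain js x where js: "js \<in> lists {1..N}" "x \<in> C" "y = word_map w js x"
        using y unfolding orbital_set_eq_words by blast
      then have "w i y = word_map w (i # js) x" by (simp add: word_map_Cons)
      moreover have "i # js \<in> lists {1..N}" using i js by simp
      ultimately show ?thesis using js unfolding orbital_set_eq_words by blast
    qed
    then have "hutchinson N w ?O \<subseteq> ?O" unfolding hutchinson_def by blast
    moreover have "C \<subseteq> ?O" unfolding orbital_set_def by blast
    ultimately show ?thesis by blast
  qed
  have "C \<union> hutchinson N w ?L \<subseteq> ?L"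
    using hutchinson_mono [OF le] by blast
  then show "?O \<subseteq> ?L" by (rule orbital_set_least)
qed

section \<open>Comparison of solutions on one factor\<close>

locale contraction_system =
  fixes M :: "'a metric" and N :: nat and w :: "nat \<Rightarrow> 'a \<Rightarrow> 'a" and c :: "nat \<Rightarrow> real"
  assumes complete: "mcomplete_of M"
    and N_pos: "N \<ge> 1"
    and contractions: "\<And>i. i \<in> {1..N} \<Longrightarrow> contraction M (c i) (w i)"
begin

sublocale Metric_space "mspace M" "mdist M"
  by (rule Metric_space_mspace_mdist)

abbreviation W :: "'a set \<Rightarrow> 'a set" where
  "W \<equiv> hutchinson N w"

lemma mem_nonempty_compacts: "A \<in> nonempty_compacts M \<longleftrightarrow> A \<noteq> {} \<and> compactin mtopology A"
  by (simp add: nonempty_compacts_def mtopology_of_def)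

lemma map_in_mspace: "i \<in> {1..N} \<Longrightarrow> x \<in> mspace M \<Longrightarrow> w i x \<in> mspace M"
  using contractions by (auto simp: contraction_def)

lemma uniform_ratio:
  obtains r where "0 \<le> r" "r < 1"
    and "\<And>i x y. i \<in> {1..N} \<Longrightarrow> x \<in> mspace M \<Longrightarrow> y \<in> mspace M \<Longrightarrow>
          mdist M (w i x) (w i y) \<le> r * mdist M x y"
proof
  let ?r = "Max (c ` {1..N})"
  have c: "0 \<le> c i" "c i < 1" if "i \<in> {1..N}" for i
    using contractions [OF that] by (auto simp: contraction_def)
  have ne: "c ` {1..N} \<noteq> {}" using N_pos by auto
  have "?r \<in> c ` {1..N}" using ne by (intro Max_in) auto
  then show "0 \<le> ?r" "?r < 1" using c by auto
  show "mdist M (w i x) (w i y) \<le> ?r * mdist M x y"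
    if i: "i \<in> {1..N}" and xy: "x \<in> mspace M" "y \<in> mspace M" for i x y
  proof -
    have "mdist M (w i x) (w i y) \<le> c i * mdist M x y"
      using contractions [OF i] xy by (auto simp: contraction_def)
    also have "\<dots> \<le> ?r * mdist M x y"
      using i by (intro mult_right_mono Max_ge) auto
    finally show ?thesis .
  qed
qed

text \<open>
  Each step of the induction moves both a point and its approximation by the same contraction, so
  the error shrinks geometrically. With a constant sequence \<open>K\<close> this is a comparison of two sets;
  with the finite stages of an orbital set it yields total boundedness.
\<close>

lemma uniform_approximation:
  assumes A: "mbounded A" "A \<subseteq> D \<union> W A"
    and K: "\<And>n. K n \<subseteq> mspace M" "K 0 \<noteq> {}" "\<And>n. D \<union> W (K n) \<subseteq> K (Suc n)"
    and "\<epsilon> > 0"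
  shows "\<exists>n. \<forall>x\<in>A. \<exists>y\<in>K n. mdist M x y < \<epsilon>"
proof -
  obtain r where r: "0 \<le> r" "r < 1"
    and lip: "\<And>i x y. i \<in> {1..N} \<Longrightarrow> x \<in> mspace M \<Longrightarrow> y \<in> mspace M \<Longrightarrow>
          mdist M (w i x) (w i y) \<le> r * mdist M x y"
    by (rule uniform_ratio) blast
  obtain b where b: "b \<in> K 0" using K by auto
  then have "mbounded (insert b A)"
    using A K by (auto simp: mbounded_insert)
  then obtain R where R: "R > 0" "\<And>x. x \<in> A \<Longrightarrow> mdist M x b \<le> R"
    unfolding mbounded_alt_pos by blast
  have A_sub: "A \<subseteq> mspace M" using A mbounded_subset_mspace by blast
  have approx: "\<exists>y\<in>K n. mdist M x y \<le> r ^ n * R" if "x \<in> A" for n x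
    using that
  proof (induction n arbitrary: x)
    case 0
    then show ?case using b R by auto
  next
    case (Suc n)
    then consider "x \<in> D" | i z where "i \<in> {1..N}" "z \<in> A" "x = w i z"
      using A by (auto simp: hutchinson_def)
    then show ?case
    proof cases
      case 1
      then have "x \<in> K (Suc n)" using K(3) by blast
      then show ?thesis
        using r R Suc.prems A_sub by (intro bexI [of _ x]) (auto simp: subset_iff)
    next
      case 2
      obtain y where y: "y \<in> K n" "mdist M z y \<le> r ^ n * R"
        using Suc.IH 2 by blast
      have "mdist M x (w i y) \<le> r * mdist M z y"
        unfolding 2(3) using 2 y A_sub K(1) [of n] by (intro lip) auto
      also have "\<dots> \<le> r * (r ^ n * R)"
        using y r by (intro mult_left_mono)
      finally have "mdist M x (w i y) \<le> r ^ Suc n * R" by simp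
      moreover have "w i y \<in> K (Suc n)"
        using K(3) [of n] 2(1) y(1) unfolding hutchinson_def by blast
      ultimately show ?thesis by blast
    qed
  qed
  obtain n where "r ^ n < \<epsilon> / R"
    using real_arch_pow_inv [of "\<epsilon> / R" r] \<open>\<epsilon> > 0\<close> R r by auto
  then have "r ^ n * R < \<epsilon>" using R by (simp add: field_simps)
  then show ?thesis
    using approx by (meson order_le_less_trans)
qed

text \<open>
  The conditions are inclusions because the sets to be compared need not solve the same equation:
  an attractor minus the orbital set is only covered by its own images.
\<close>

lemma comparison:
  assumes A: "mbounded A" "A \<subseteq> D \<union> W A"
    and B: "closedin mtopology B" "B \<noteq> {}" "D \<union> W B \<subseteq> B"
  shows "A \<subseteq> B"
proof
  fix x assume x: "x \<in> A"
  have B_sub: "B \<subseteq> mspace M" using B closedin_subset by fastforce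
  have x_in: "x \<in> mspace M" using A x mbounded_subset_mspace by blast
  have "\<exists>y\<in>B. mdist M x y < \<epsilon>" if "\<epsilon> > 0" for \<epsilon>
    using uniform_approximation [OF A, of "\<lambda>_. B" \<epsilon>] B B_sub that x by auto
  then have "x \<in> mtopology closure_of B"
    using x_in B_sub by (auto simp: metric_closure_of subset_iff)
  then show "x \<in> B" using B by (simp add: closure_of_closedin)
qed

lemma compact_solution_unique:
  assumes "F \<in> nonempty_compacts M" "F = D \<union> W F"
    and "G \<in> nonempty_compacts M" "G = D \<union> W G"
  shows "F = G"
proof -
  have "A \<subseteq> B" if "A \<in> nonempty_compacts M" "A = D \<union> W A"
    "B \<in> nonempty_compacts M" "B = D \<union> W B" for A B
  proof (rule comparison)
    show "mbounded A" "closedin mtopology B" "B \<noteq> {}"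
      using that(1,3) by (auto simp: mem_nonempty_compacts compactin_imp_mbounded
          compactin_imp_closedin Hausdorff_space_mtopology)
    show "A \<subseteq> D \<union> W A" using that(2) by (rule equalityD1)
    show "D \<union> W B \<subseteq> B" using that(4) by (rule equalityD2)
  qed
  then show ?thesis using assms by blast
qed

section \<open>Existence of the attractors\<close>

lemma continuous_maps: "i \<in> {1..N} \<Longrightarrow> continuous_map mtopology mtopology (w i)"
proof -
  assume "i \<in> {1..N}"
  then have "Lipschitz_continuous_map M M (w i)"
    using contractions by (auto simp: contraction_def Lipschitz_continuous_map_def)
  then show ?thesis
    using Lipschitz_continuous_imp_continuous_map by (fastforce simp: mtopology_of_def)
qed

lemma compactin_hutchinson: "compactin mtopology A \<Longrightarrow> compactin mtopology (W A)"
  unfolding hutchinson_def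
  by (intro compactin_Union) (auto intro!: image_compactin [OF _ continuous_maps])

text \<open>
  If \<open>D\<close> lies within \<open>R\<close> of \<open>p\<close> and every contraction moves \<open>p\<close> by at most \<open>(1 - r) * R\<close>, then the
  ball of radius \<open>R\<close> about \<open>p\<close> is mapped into itself and so contains the orbit of \<open>D\<close>.
\<close>

lemma mbounded_orbital_set:
  assumes "mbounded D" "D \<noteq> {}"
  shows "mbounded (orbital_set N w D)"
proof -
  obtain r where r: "0 \<le> r" "r < 1"
    and lip: "\<And>i x y. i \<in> {1..N} \<Longrightarrow> x \<in> mspace M \<Longrightarrow> y \<in> mspace M \<Longrightarrow>
          mdist M (w i x) (w i y) \<le> r * mdist M x y"
    by (rule uniform_ratio) blast
  obtain p where p: "p \<in> D" using assms by auto
  then have pM: "p \<in> mspace M" using assms mbounded_subset_mspace by blast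
  obtain S where S: "\<And>x. x \<in> D \<Longrightarrow> mdist M p x \<le> S"
    using assms p unfolding mbounded_alt by blast
  define t where "t = Max ((\<lambda>i. mdist M p (w i p)) ` {1..N})"
  have t: "mdist M p (w i p) \<le> t" if "i \<in> {1..N}" for i
    using that by (auto simp: t_def)
  define R where "R = max S (t / (1 - r))"
  have "t / (1 - r) \<le> R" by (simp add: R_def)
  then have tR: "t \<le> (1 - r) * R"
    using r by (simp add: pos_divide_le_eq mult.commute)
  have "w i x \<in> mcball p R" if i: "i \<in> {1..N}" and x: "x \<in> mcball p R" for i x
  proof -
    have "mdist M p (w i x) \<le> mdist M p (w i p) + mdist M (w i p) (w i x)"
      using i x pM by (intro triangle) (auto simp: map_in_mspace)
    also have "\<dots> \<le> (1 - r) * R + r * mdist M p x"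
      using t [OF i] lip [OF i pM, of x] x tR by (intro add_mono) (linarith, simp)
    also have "\<dots> \<le> (1 - r) * R + r * R"
      using x r by (simp add: mult_left_mono)
    finally show ?thesis
      using i x pM by (auto simp: map_in_mspace algebra_simps)
  qed
  then have "W (mcball p R) \<subseteq> mcball p R" by (auto simp: hutchinson_def)
  moreover have "D \<subseteq> mcball p R"
    using S assms mbounded_subset_mspace pM by (force simp: R_def)
  ultimately have "orbital_set N w D \<subseteq> mcball p R"
    by (intro orbital_set_least) auto
  then show ?thesis by (rule mbounded_subset [OF mbounded_mcball])
qed

text \<open>
  The sets \<open>K n\<close> below collect the images of \<open>D\<close> under words of length at most \<open>n\<close>; they are compact
  and lie in the orbital set, so finite nets for them are finite nets for the orbital set.
\<close>

lemma mtotally_bounded_orbital_set: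
  assumes "D \<in> nonempty_compacts M"
  shows "mtotally_bounded (orbital_set N w D)"
  unfolding mtotally_bounded_def
proof (intro strip)
  fix \<epsilon> :: real assume "\<epsilon> > 0"
  let ?O = "orbital_set N w D"
  define K where "K n = ((\<lambda>B. D \<union> W B) ^^ n) D" for n
  have K0: "K 0 = D" and KSuc: "K (Suc n) = D \<union> W (K n)" for n
    by (simp_all add: K_def)
  have D: "D \<noteq> {}" "compactin mtopology D"
    using assms by (auto simp: mem_nonempty_compacts)
  have O: "D \<union> W ?O = ?O" by (rule orbital_set_fixed)
  have K_compact: "compactin mtopology (K n)" for n
    by (induction n) (auto simp: K0 KSuc D compactin_hutchinson compactin_Un)
  have K_sub: "K n \<subseteq> ?O" for n
  proof (induction n)
    case 0
    then show ?case using O unfolding K0 by blast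
  next
    case (Suc n)
    then show ?case using O hutchinson_mono [OF Suc] unfolding KSuc by blast
  qed
  have bdd: "mbounded ?O"
    using compactin_imp_mbounded [OF D(2)] D(1) by (rule mbounded_orbital_set)
  have "\<exists>n. \<forall>x\<in>?O. \<exists>y\<in>K n. mdist M x y < \<epsilon> / 2"
  proof (rule uniform_approximation [OF bdd, where D = D and K = K])
    show "?O \<subseteq> D \<union> W ?O" using O by (rule equalityD2)
    show "K n \<subseteq> mspace M" for n
      using compactin_subset_topspace [OF K_compact] by simp
    show "K 0 \<noteq> {}" using D by (simp add: K0)
    show "D \<union> W (K n) \<subseteq> K (Suc n)" for n by (simp add: KSuc)
    show "\<epsilon> / 2 > 0" using \<open>\<epsilon> > 0\<close> by simp
  qed
  then obtain n where n: "\<And>x. x \<in> ?O \<Longrightarrow> \<exists>y\<in>K n. mdist M x y < \<epsilon> / 2"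
    by blast
  have "\<epsilon> / 2 > 0" using \<open>\<epsilon> > 0\<close> by simp
  have "\<exists>T. finite T \<and> T \<subseteq> K n \<and> K n \<subseteq> (\<Union>x\<in>T. mball x (\<epsilon> / 2))"
    using compactin_imp_mtotally_bounded [OF K_compact, of n] \<open>\<epsilon> / 2 > 0\<close>
    unfolding mtotally_bounded_def by simp
  then obtain T where T: "finite T" "T \<subseteq> K n" "K n \<subseteq> (\<Union>x\<in>T. mball x (\<epsilon> / 2))"
    by auto
  have "?O \<subseteq> (\<Union>x\<in>T. mball x \<epsilon>)"
  proof
    fix x assume x: "x \<in> ?O"
    then have xM: "x \<in> mspace M" using bdd mbounded_subset_mspace by blast
    obtain y where y: "y \<in> K n" "mdist M x y < \<epsilon> / 2" using n x by blast
    then obtain z where z: "z \<in> T" "y \<in> mball z (\<epsilon> / 2)" using T by blast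
    have "mdist M z x \<le> mdist M z y + mdist M x y"
      using triangle [of z y x] z xM commute [of y x] by auto
    then have "x \<in> mball z \<epsilon>" using y z xM by auto
    then show "x \<in> (\<Union>x\<in>T. mball x \<epsilon>)" using z by blast
  qed
  then show "\<exists>T. finite T \<and> T \<subseteq> ?O \<and> ?O \<subseteq> (\<Union>x\<in>T. mball x \<epsilon>)"
    using T(1) order_trans [OF T(2) K_sub] by (intro exI [of _ T] conjI)
qed

text \<open>
  The closure of the orbital set inherits its fixed-point equation because the contractions are
  continuous and the closure is compact: images of the closure are then closed.
\<close>

lemma compact_solution_exists:
  assumes D: "D \<in> nonempty_compacts M"
  obtains F where "F \<in> nonempty_compacts M" "F = D \<union> W F"
proof
  let ?O = "orbital_set N w D"
  let ?F = "mtopology closure_of ?O"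
  have "mcomplete" using complete by (simp add: mcomplete_of_def)
  then have O_sub: "?O \<subseteq> mspace M" and F: "compactin mtopology ?F"
    using mtotally_bounded_orbital_set [OF D] mtotally_bounded_eq_compact_closure_of by blast+
  have O: "D \<union> W ?O = ?O" by (rule orbital_set_fixed)
  have O_F: "?O \<subseteq> ?F" using O_sub by (simp add: closure_of_subset)
  have D': "D \<noteq> {}" "compactin mtopology D"
    using D by (auto simp: mem_nonempty_compacts)
  show "?F \<in> nonempty_compacts M"
    using F D' O O_F by (auto simp: mem_nonempty_compacts)
  show "?F = D \<union> W ?F"
  proof
    have "closedin mtopology (D \<union> W ?F)"
      using F D' by (intro compactin_imp_closedin Hausdorff_space_mtopology compactin_Un
          compactin_hutchinson)
    moreover have "?O \<subseteq> D \<union> W ?F"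
      using O hutchinson_mono [OF O_F] by blast
    ultimately show "?F \<subseteq> D \<union> W ?F" by (simp add: closure_of_minimal)
    have "w i ` ?F \<subseteq> ?F" if i: "i \<in> {1..N}" for i
    proof -
      have "w i ` ?F \<subseteq> mtopology closure_of (w i ` ?O)"
        using continuous_maps [OF i]
        by (simp add: continuous_map_eq_image_closure_subset image_subset_iff_funcset)
      also have "\<dots> \<subseteq> ?F"
      proof (rule closure_of_mono)
        have "w i ` ?O \<subseteq> W ?O" unfolding hutchinson_def using i by (rule UN_upper)
        then show "w i ` ?O \<subseteq> ?O" using equalityD1 [OF O] by blast
      qed
      finally show ?thesis .
    qed
    then have "W ?F \<subseteq> ?F" unfolding hutchinson_def by (rule UN_least)
    moreover have "D \<subseteq> ?F" using O O_F by blast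
    ultimately show "D \<union> W ?F \<subseteq> ?F" by (rule Un_least [rotated])
  qed
qed

lemma inhomogeneous_attractor_unique:
  assumes "C \<in> nonempty_compacts M" "F \<in> nonempty_compacts M" "F = C \<union> W F"
  shows "inhomogeneous_attractor M N w C = F"
  unfolding inhomogeneous_attractor_def Union_set_map_eq
proof (rule the_equality)
  show "F \<in> nonempty_compacts M \<and> F = C \<union> W F" using assms(2,3) by (rule conjI)
  show "G = F" if "G \<in> nonempty_compacts M \<and> G = C \<union> W G" for G
    using compact_solution_unique [OF conjunct1 [OF that] conjunct2 [OF that] assms(2,3)] .
qed

lemma inhomogeneous_attractor:
  assumes "C \<in> nonempty_compacts M"
  shows "inhomogeneous_attractor M N w C \<in> nonempty_compacts M"
    and "inhomogeneous_attractor M N w C = C \<union> W (inhomogeneous_attractor M N w C)"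
proof -
  obtain F where F: "F \<in> nonempty_compacts M" "F = C \<union> W F"
    using assms by (rule compact_solution_exists)
  have eq: "inhomogeneous_attractor M N w C = F"
    using assms F by (rule inhomogeneous_attractor_unique)
  show "inhomogeneous_attractor M N w C \<in> nonempty_compacts M"
    and "inhomogeneous_attractor M N w C = C \<union> W (inhomogeneous_attractor M N w C)"
    unfolding eq by (fact F)+
qed

lemma homogeneous_attractor:
  assumes "mspace M \<noteq> {}"
  shows "homogeneous_attractor M N w \<in> nonempty_compacts M"
    and "homogeneous_attractor M N w = W (homogeneous_attractor M N w)"
proof -
  have 1: "1 \<in> {1..N}" using N_pos by simp
  then have w1: "contraction M (c 1) (w 1)" by (rule contractions)
  have "mcomplete" using complete by (simp add: mcomplete_of_def)
  then obtain p where p: "p \<in> mspace M" "w 1 p = p"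
    using Banach_fixedpoint_thm [of "w 1" "c 1"] w1 assms
    by (auto simp: contraction_def)
  then have "{p} \<in> nonempty_compacts M"
    by (simp add: mem_nonempty_compacts finite_imp_compactin)
  then obtain F where F: "F \<in> nonempty_compacts M" "F = {p} \<union> W F"
    by (rule compact_solution_exists)
  \<comment> \<open>The point \<open>p\<close> is its own image under \<open>w 1\<close>, so \<open>W F\<close> already contains it and \<open>F = W F\<close>.\<close>
  have "p \<in> F" using equalityD2 [OF F(2)] by blast
  then have "p \<in> W F"
    unfolding hutchinson_def using p(2) by (intro UN_I [OF 1] image_eqI [of _ _ p]) simp_all
  then have "{p} \<union> W F = W F" by blast
  with F(2) have fixed: "F = W F" by (rule trans)
  have eq: "homogeneous_attractor M N w = F"
    unfolding homogeneous_attractor_def hutchinson_def [symmetric]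
  proof (rule the_equality)
    show "F \<in> nonempty_compacts M \<and> F = W F" using F(1) fixed by (rule conjI)
    show "G = F" if "G \<in> nonempty_compacts M \<and> G = W G" for G
      using compact_solution_unique [of G "{}" F] that F(1) fixed
      unfolding Un_empty_left by metis
  qed
  show "homogeneous_attractor M N w \<in> nonempty_compacts M"
    and "homogeneous_attractor M N w = W (homogeneous_attractor M N w)"
    unfolding eq by (fact F(1) fixed)+
qed

theorem inhomogeneous_attractor_eq:
  assumes C: "C \<in> nonempty_compacts M"
  shows "inhomogeneous_attractor M N w C = orbital_set N w C \<union> homogeneous_attractor M N w"
proof -
  let ?O = "orbital_set N w C"
  define G where "G = inhomogeneous_attractor M N w C"
  define F where "F = homogeneous_attractor M N w"
  have G: "G \<in> nonempty_compacts M" "G = C \<union> W G"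
    using inhomogeneous_attractor [OF C] unfolding G_def .
  have "C \<noteq> {}" "C \<subseteq> mspace M"
    using C compactin_subset_topspace by (fastforce simp: mem_nonempty_compacts)+
  then have F: "F \<in> nonempty_compacts M" "F = W F"
    unfolding F_def by (auto intro!: homogeneous_attractor)
  have bounded: "mbounded G" "mbounded F" and closed: "closedin mtopology G" "closedin mtopology F"
    and nonempty: "G \<noteq> {}" "F \<noteq> {}"
    using F(1) G(1) by (auto simp: mem_nonempty_compacts compactin_imp_mbounded
        compactin_imp_closedin Hausdorff_space_mtopology)
  have "?O \<subseteq> G" by (intro orbital_set_least equalityD2) (rule G(2))
  moreover have "F \<subseteq> G"
  proof (rule comparison [of _ "{}"])
    show "F \<subseteq> {} \<union> W F" using equalityD1 [OF F(2)] by simp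
    show "{} \<union> W G \<subseteq> G" using equalityD2 [OF G(2)] by simp
  qed (fact bounded closed nonempty)+
  \<comment> \<open>The orbital set is closed under the contractions and contains \<open>C\<close>, so a point of \<open>G\<close> outside
    it comes from a point of \<open>G\<close> that is outside it as well.\<close>
  moreover have "G - ?O \<subseteq> F"
  proof (rule comparison [of _ "{}"])
    show "mbounded (G - ?O)" using bounded mbounded_subset by blast
    show "G - ?O \<subseteq> {} \<union> W (G - ?O)"
    proof
      fix x assume x: "x \<in> G - ?O"
      have O: "C \<union> W ?O = ?O" by (rule orbital_set_fixed)
      have "x \<in> W G" using equalityD1 [OF G(2)] equalityD1 [OF O] x by blast
      then obtain i y where y: "i \<in> {1..N}" "y \<in> G" "x = w i y"
        by (auto simp: hutchinson_def)
      have "y \<notin> ?O"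
      proof
        assume "y \<in> ?O"
        then have "x \<in> W ?O" using y by (auto simp: hutchinson_def)
        then show False using equalityD1 [OF O] x by blast
      qed
      then show "x \<in> {} \<union> W (G - ?O)" using y by (auto simp: hutchinson_def)
    qed
    show "{} \<union> W F \<subseteq> F" using equalityD2 [OF F(2)] by simp
  qed (fact closed nonempty)+
  ultimately show ?thesis unfolding G_def F_def by blast
qed

end

section \<open>The product operator on boxes\<close>

text \<open>
  Choosing an index tuple amounts to choosing an index independently in each factor. The factors
  have to be nonempty for a box to determine them.
\<close>

lemma T_theta_box:
  assumes "\<And>k. k \<in> {1..m} \<Longrightarrow> A k \<noteq> {}"
  shows "T_theta m N w C (PiE {1..m} A) = (\<Pi>\<^sub>E k\<in>{1..m}. C k \<union> hutchinson (N k) (w k) (A k))"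
proof -
  have proj: "(\<lambda>x. x k) ` PiE {1..m} A = A k" if "k \<in> {1..m}" for k
    using assms that by (simp add: image_projection_PiE PiE_eq_empty_iff)
  have "box_map m w C i (PiE {1..m} A) = (\<Pi>\<^sub>E k\<in>{1..m}. set_map (w k) (C k) (i k) (A k))" for i
    unfolding box_map_def by (intro PiE_cong) (rule arg_cong [OF proj])
  then have "T_theta m N w C (PiE {1..m} A) =
      (\<Union>i\<in>(\<Pi>\<^sub>E k\<in>{1..m}. {0..N k}). \<Pi>\<^sub>E k\<in>{1..m}. set_map (w k) (C k) (i k) (A k))"
    unfolding T_theta_def by (intro SUP_cong refl)
  also have "\<dots> = (\<Pi>\<^sub>E k\<in>{1..m}. \<Union>i\<in>{0..N k}. set_map (w k) (C k) i (A k))" (is "?L = ?R")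
  proof
    show "?L \<subseteq> ?R"
    proof (intro UN_least PiE_mono)
      fix i k assume "i \<in> (\<Pi>\<^sub>E k\<in>{1..m}. {0..N k})" "k \<in> {1..m}"
      then have "i k \<in> {0..N k}" by (rule PiE_mem)
      then show "set_map (w k) (C k) (i k) (A k) \<subseteq> (\<Union>i\<in>{0..N k}. set_map (w k) (C k) i (A k))"
        by (rule UN_upper)
    qed
    show "?R \<subseteq> ?L"
    proof
      fix x assume x: "x \<in> ?R"
      then have "\<exists>i. i \<in> {0..N k} \<and> x k \<in> set_map (w k) (C k) i (A k)" if "k \<in> {1..m}" for k
        using PiE_mem [OF x that] by blast
      then obtain i where i: "\<And>k. k \<in> {1..m} \<Longrightarrow> i k \<in> {0..N k}"
          "\<And>k. k \<in> {1..m} \<Longrightarrow> x k \<in> set_map (w k) (C k) (i k) (A k)"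
        by metis
      show "x \<in> ?L"
      proof (rule UN_I)
        show "restrict i {1..m} \<in> (\<Pi>\<^sub>E k\<in>{1..m}. {0..N k})"
          using i(1) by (rule restrict_PiE_iff [THEN iffD2, OF ballI])
        show "x \<in> (\<Pi>\<^sub>E k\<in>{1..m}. set_map (w k) (C k) (restrict i {1..m} k) (A k))"
        proof (rule PiE_I)
          show "x k \<in> set_map (w k) (C k) (restrict i {1..m} k) (A k)" if "k \<in> {1..m}" for k
            unfolding restrict_apply' [OF that] using that by (rule i(2))
          show "x k = undefined" if "k \<notin> {1..m}" for k
            using x that by (rule PiE_arb)
        qed
      qed
    qed
  qed
  finally show ?thesis by (simp only: Union_set_map_eq)
qed

lemma T_theta_fixed_box_iff:
  assumes "\<And>k. k \<in> {1..m} \<Longrightarrow> A k \<noteq> {}" "\<And>k. k \<in> {1..m} \<Longrightarrow> C k \<noteq> {}"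
  shows "T_theta m N w C (PiE {1..m} A) = PiE {1..m} A \<longleftrightarrow>
           (\<forall>k\<in>{1..m}. A k = C k \<union> hutchinson (N k) (w k) (A k))"
proof -
  have box: "T_theta m N w C (PiE {1..m} A) = (\<Pi>\<^sub>E k\<in>{1..m}. C k \<union> hutchinson (N k) (w k) (A k))"
    using assms(1) by (rule T_theta_box)
  have factors: "PiE {1..m} A = (\<Pi>\<^sub>E k\<in>{1..m}. C k \<union> hutchinson (N k) (w k) (A k)) \<longleftrightarrow>
      (\<forall>k\<in>{1..m}. A k = C k \<union> hutchinson (N k) (w k) (A k))"
    using assms by (intro PiE_eq_iff_not_empty) auto
  show ?thesis
    unfolding box factors [symmetric] by (rule eq_commute)
qed

theorem theorem4p1:
  fixes m :: nat
    and X :: "nat \<Rightarrow> 'a metric"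
    and N :: "nat \<Rightarrow> nat"
    and w :: "nat \<Rightarrow> nat \<Rightarrow> 'a \<Rightarrow> 'a"
    and c :: "nat \<Rightarrow> nat \<Rightarrow> real"
    and C :: "nat \<Rightarrow> 'a set"
  assumes "m \<ge> 1"
    and "\<And>k. k \<in> {1..m} \<Longrightarrow> mcomplete_of (X k)"
    and "\<And>k. k \<in> {1..m} \<Longrightarrow> N k \<ge> 1"
    and "\<And>k i. k \<in> {1..m} \<Longrightarrow> i \<in> {1..N k} \<Longrightarrow> contraction (X k) (c k i) (w k i)"
    and "\<And>k. k \<in> {1..m} \<Longrightarrow> C k \<in> nonempty_compacts (X k)"
  shows "product_attractor m X N w C =
           (\<Pi>\<^sub>E k\<in>{1..m}. inhomogeneous_attractor (X k) (N k) (w k) (C k)) \<and>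
         product_attractor m X N w C =
           (\<Pi>\<^sub>E k\<in>{1..m}. orbital_set (N k) (w k) (C k) \<union>
                          homogeneous_attractor (X k) (N k) (w k))"
proof -
  have sys: "contraction_system (X k) (N k) (w k) (c k)" if "k \<in> {1..m}" for k
    using assms that by unfold_locales auto
  define F where "F = (\<lambda>k. inhomogeneous_attractor (X k) (N k) (w k) (C k))"
  have F: "F k \<in> nonempty_compacts (X k)" "F k = C k \<union> hutchinson (N k) (w k) (F k)"
    if "k \<in> {1..m}" for k
    using contraction_system.inhomogeneous_attractor [OF sys [OF that] assms(5) [OF that]]
    unfolding F_def .
  have C: "C k \<noteq> {}" if "k \<in> {1..m}" for k
    using assms(5) [OF that] by (simp add: nonempty_compacts_def)
  have prod: "product_attractor m X N w C = PiE {1..m} F"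
    unfolding product_attractor_def
  proof (rule the_equality, intro conjI)
    show "PiE {1..m} F \<in> compact_boxes m X"
      unfolding compact_boxes_def
      by (intro CollectI exI [of _ F] conjI refl ballI F(1))
    show "T_theta m N w C (PiE {1..m} F) = PiE {1..m} F"
    proof (rule T_theta_fixed_box_iff [THEN iffD2])
      show "F k \<noteq> {}" if "k \<in> {1..m}" for k
        using F(1) [OF that] by (simp add: nonempty_compacts_def)
      show "\<forall>k\<in>{1..m}. F k = C k \<union> hutchinson (N k) (w k) (F k)"
        using F(2) by (rule ballI)
    qed (rule C)
  next
    fix B assume B: "B \<in> compact_boxes m X \<and> T_theta m N w C B = B"
    then obtain A where A: "B = PiE {1..m} A" "\<And>k. k \<in> {1..m} \<Longrightarrow> A k \<in> nonempty_compacts (X k)"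
      by (auto simp: compact_boxes_def)
    then have "A k \<noteq> {}" if "k \<in> {1..m}" for k
      using that by (auto simp: nonempty_compacts_def)
    moreover have "T_theta m N w C (PiE {1..m} A) = PiE {1..m} A"
      using B unfolding A(1) by (rule conjunct2)
    ultimately have fixed: "\<forall>k\<in>{1..m}. A k = C k \<union> hutchinson (N k) (w k) (A k)"
      using T_theta_fixed_box_iff [of m A C N w, THEN iffD1] C by simp
    have "F k = A k" if k: "k \<in> {1..m}" for k
      unfolding F_def
      using sys [OF k] assms(5) [OF k] A(2) [OF k] bspec [OF fixed k]
      by (rule contraction_system.inhomogeneous_attractor_unique)
    then show "B = PiE {1..m} F"
      unfolding A(1) by (intro PiE_cong) simp
  qed
  have factors: "PiE {1..m} F = (\<Pi>\<^sub>E k\<in>{1..m}. orbital_set (N k) (w k) (C k) \<union>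
                          homogeneous_attractor (X k) (N k) (w k))"
    unfolding F_def
    by (intro PiE_cong contraction_system.inhomogeneous_attractor_eq [OF sys] assms(5))
  show ?thesis
    using prod trans [OF prod factors] unfolding F_def by (rule conjI)
qed

end
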